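(* Let $G_1$ and $G_2$ be simple connected graphs with $n_1$ and $n_2$ vertices respectively, with signless Laplacian matrices $Q_1,Q_2$. Then the $Q$-polynomial of the join $G_1\vee G_2$ satisfies \begin{align*} f_{Q(G_1 \vee G_2 )}(\lambda) = &\; ( - 1)^{n_2 } f_{Q_1 } (\lambda - n_2 )f_{\overline {Q_2 } } (n_1 + n_2 - \lambda - 2)\\ & + ( - 1)^{n_1 } f_{Q_2 } (\lambda - n_1 )f_{\overline {Q_1 } } (n_1 + n_2 - \lambda - 2)\\ & - ( - 1)^{n_1 + n_2 } f_{\overline {Q_1 } } (n_1 + n_2 - \lambda - 2)f_{\overline {Q_2 } } (n_1 + n_2 - \lambda - 2). \end{align*}
   Context: For a simple graph $H$ on $m$ vertices, $Q(H)=D(H)+A(H)$ is its signless Laplacian (degree diagonal matrix plus adjacency matrix), and $f_{Q(H)}(\lambda)=\det(\lambda I_m-Q(H))$. Here $f_{Q_i}(\lambda)=\det(\lambda I_{n_i}-Q(G_i))$ and $f_{\overline{Q_i}}(\lambda)=\det(\lambda I_{n_i}-Q(\overline{G_i}))$, where $\overline{G_i}$ is the complement of $G_i$. The join $G_1\vee G_2$ of graphs with disjoint vertex sets is the disjoint union $G_1\cup G_2$ together with all edges joining a vertex of $G_1$ to a vertex of $G_2$. *)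

theory Defs
  imports "Graph_Theory.Graph_Theory" "Jordan_Normal_Form.Char_Poly"
begin

text \<open>
  A finite simple graph is a \<open>pair_graph\<close>: an edge between u and v is represented by the two arcs
  (u, v) and (v, u), so that \<open>out_degree\<close> is the usual degree. Matrices are indexed by positions
  in a list enumerating the vertices.
\<close>

definition graph_complement :: "'a pair_pre_digraph \<Rightarrow> 'a pair_pre_digraph" where
  "graph_complement G =
     \<lparr> pverts = pverts G,
       parcs = {(u, v). u \<in> pverts G \<and> v \<in> pverts G \<and> u \<noteq> v \<and> (u, v) \<notin> parcs G} \<rparr>"

text \<open>This is the join only if the two vertex sets are disjoint.\<close>

definition graph_join :: "'a pair_pre_digraph \<Rightarrow> 'a pair_pre_digraph \<Rightarrow> 'a pair_pre_digraph" where
  "graph_join G H =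
     \<lparr> pverts = pverts G \<union> pverts H,
       parcs = parcs G \<union> parcs H \<union> (pverts G \<times> pverts H) \<union> (pverts H \<times> pverts G) \<rparr>"

definition enumerates_vertices :: "'a list \<Rightarrow> 'a pair_pre_digraph \<Rightarrow> bool" where
  "enumerates_vertices vs G \<longleftrightarrow> distinct vs \<and> set vs = pverts G"

definition adjacency_mat :: "'a list \<Rightarrow> 'a pair_pre_digraph \<Rightarrow> real mat" where
  "adjacency_mat vs G =
     Matrix.mat (length vs) (length vs)
       (\<lambda>(i, j). if (vs ! i, vs ! j) \<in> parcs G then 1 else 0)"

definition degree_mat :: "'a list \<Rightarrow> 'a pair_pre_digraph \<Rightarrow> real mat" where
  "degree_mat vs G = mat_diag (length vs) (\<lambda>i. real (out_degree (with_proj G) (vs ! i)))"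

definition signless_laplacian :: "'a list \<Rightarrow> 'a pair_pre_digraph \<Rightarrow> real mat" where
  "signless_laplacian vs G = degree_mat vs G + adjacency_mat vs G"

definition Q_poly :: "'a list \<Rightarrow> 'a pair_pre_digraph \<Rightarrow> real poly" where
  "Q_poly vs G = char_poly (signless_laplacian vs G)"

end

theory Submission
  imports Defs
begin

text \<open>
  Write \<open>M\<^sub>1 = (\<lambda> - n\<^sub>2) I - Q\<^sub>1\<close>, \<open>M\<^sub>2 = (\<lambda> - n\<^sub>1) I - Q\<^sub>2\<close> and \<open>J\<close> for all-ones
  matrices. Since the complement of \<open>G\<^sub>i\<close> has signless Laplacian \<open>(n\<^sub>i - 2) I + J - Q\<^sub>i\<close>, its
  characteristic polynomial at \<open>n\<^sub>1 + n\<^sub>2 - \<lambda> - 2\<close> is, up to sign, \<open>det (M\<^sub>i + J)\<close>. The characteristic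
  matrix of the join is the block diagonal matrix \<open>K = diag (M\<^sub>1 + J, M\<^sub>2 + J)\<close> minus \<open>J\<close>.
  The map \<open>u \<mapsto> det (K + u e\<^sup>T)\<close>, \<open>e\<close> being the all-ones vector, is affine in the
  column \<open>u\<close>, and splitting \<open>u = - e\<close> along the two blocks leaves two block triangular matrices whose
  determinants are \<open>det M\<^sub>1 det (M\<^sub>2 + J)\<close> and \<open>det (M\<^sub>1 + J) det M\<^sub>2\<close>.
\<close>

section \<open>Determinants under rank-one perturbations\<close>

text \<open>Border \<open>N\<close> by the row \<open>w\<close>, the column \<open>- u\<close> and
  the corner 1. Eliminating the row gives the perturbed determinant without inverting
  \<open>N\<close>, and only one column of the bordered matrix involves \<open>u\<close>.\<close>

lemma det_add_rank_one_affine: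
  fixes N :: "'a :: idom mat" and w :: "nat \<Rightarrow> 'a"
  assumes N: "N \<in> carrier_mat n n"
  obtains c where "\<And>u. det (Matrix.mat n n (\<lambda>(i, j). N $$ (i, j) + u i * w j)) = det N + (\<Sum>i<n. u i * c i)"
proof -
  define B where "B u = four_block_mat (1\<^sub>m 1) (Matrix.mat 1 n (\<lambda>(i, j). w j))
    (Matrix.mat n 1 (\<lambda>(i, j). - u i)) N" for u :: "nat \<Rightarrow> 'a"
  \<comment> \<open>Right multiplication by \<open>C\<close> subtracts \<open>w j\<close> times the
    border column from column \<open>j\<close>: the border row vanishes and \<open>N\<close> becomes
    \<open>N\<close> plus \<open>u i * w j\<close>.\<close>
  define C where "C = four_block_mat (1\<^sub>m 1) (Matrix.mat 1 n (\<lambda>(i, j). - w j)) (0\<^sub>m n 1) (1\<^sub>m n)"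
  have B: "B u \<in> carrier_mat (Suc n) (Suc n)" for u
    using four_block_carrier_mat[OF one_carrier_mat[of 1] N] by (simp add: B_def)
  have C: "C \<in> carrier_mat (Suc n) (Suc n)"
    using four_block_carrier_mat[OF one_carrier_mat[of 1] one_carrier_mat[of n]] by (simp add: C_def)
  have "det C = 1"
    unfolding C_def
    using det_four_block_mat_lower_left_zero[OF one_carrier_mat[of 1] mat_carrier refl one_carrier_mat[of n]]
    by simp
  have detB: "det (B u) = det (Matrix.mat n n (\<lambda>(i, j). N $$ (i, j) + u i * w j))" for u
  proof -
    have "B u * C = four_block_mat (1\<^sub>m 1) (0\<^sub>m 1 n) (Matrix.mat n 1 (\<lambda>(i, j). - u i))
        (Matrix.mat n n (\<lambda>(i, j). N $$ (i, j) + u i * w j))"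
      unfolding B_def C_def
      using N by (subst mult_four_block_mat[of _ 1 1 _ n _ n _ _ 1 _ n])
        (auto intro!: cong_four_block_mat eq_matI simp: scalar_prod_def)
    then have "det (B u * C) = det (Matrix.mat n n (\<lambda>(i, j). N $$ (i, j) + u i * w j))"
      by (simp add: det_four_block_mat_upper_right_zero[where n = 1 and m = n])
    then show ?thesis
      using det_mult[OF B[of u] C] \<open>det C = 1\<close> by simp
  qed
  \<comment> \<open>Deleting column 0 removes every entry that depends on \<open>u\<close>.\<close>
  have cofactor: "cofactor (B u) i 0 = cofactor (B (\<lambda>_. 0)) i 0" if "i < Suc n" for u i
  proof -
    have "mat_delete (B u) i 0 = mat_delete (B (\<lambda>_. 0)) i 0"
      using that N by (intro eq_matI) (auto simp: mat_delete_def B_def)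
    then show ?thesis by (simp add: cofactor_def)
  qed
  have expand: "det (B u) = cofactor (B (\<lambda>_. 0)) 0 0
      + (\<Sum>i<n. u i * - cofactor (B (\<lambda>_. 0)) (Suc i) 0)" for u
  proof -
    have "det (B u) = (\<Sum>i<Suc n. B u $$ (i, 0) * cofactor (B (\<lambda>_. 0)) i 0)"
      unfolding laplace_expansion_column[OF B[of u] zero_less_Suc]
      by (intro sum.cong) (simp_all only: lessThan_iff cofactor[of _ u])
    also have "\<dots> = B u $$ (0, 0) * cofactor (B (\<lambda>_. 0)) 0 0
        + (\<Sum>i<n. B u $$ (Suc i, 0) * cofactor (B (\<lambda>_. 0)) (Suc i) 0)"
      by (rule sum.lessThan_Suc_shift)
    also have "\<dots> = cofactor (B (\<lambda>_. 0)) 0 0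
        + (\<Sum>i<n. u i * - cofactor (B (\<lambda>_. 0)) (Suc i) 0)"
      using N by (intro arg_cong2[where f = "(+)"] sum.cong) (auto simp: B_def)
    finally show ?thesis .
  qed
  \<comment> \<open>Setting \<open>u = 0\<close> identifies the constant term of the expansion as
    \<open>det N\<close>.\<close>
  have "Matrix.mat n n (\<lambda>(i, j). N $$ (i, j) + 0 * w j) = N"
    using N by (intro eq_matI) auto
  then have "det (B (\<lambda>_. 0)) = det N"
    by (simp only: detB)
  then have "det N = cofactor (B (\<lambda>_. 0)) 0 0"
    by (simp add: expand)
  then show thesis
    by (intro that[of "\<lambda>i. - cofactor (B (\<lambda>_. 0)) (Suc i) 0"]) (simp only: detB[symmetric] expand)
qed

text \<open>An affine map \<open>F\<close> satisfies
  \<open>F (u + v) = F u + F v - F 0\<close>.\<close>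

lemma det_add_rank_one_split:
  fixes N :: "'a :: idom mat"
  assumes N: "N \<in> carrier_mat n n"
  shows "det (Matrix.mat n n (\<lambda>(i, j). N $$ (i, j) + (u i + v i) * w j))
    = det (Matrix.mat n n (\<lambda>(i, j). N $$ (i, j) + u i * w j))
      + det (Matrix.mat n n (\<lambda>(i, j). N $$ (i, j) + v i * w j)) - det N"
proof -
  obtain c where c: "\<And>u. det (Matrix.mat n n (\<lambda>(i, j). N $$ (i, j) + u i * w j)) = det N + (\<Sum>i<n. u i * c i)"
    using det_add_rank_one_affine[OF N] by blast
  show ?thesis
    unfolding c[of "\<lambda>i. u i + v i"] c[of u] c[of v] by (simp add: distrib_right sum.distrib)
qed

abbreviation ones_mat :: "nat \<Rightarrow> nat \<Rightarrow> 'a :: one mat" where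
  "ones_mat n m \<equiv> Matrix.mat n m (\<lambda>_. 1)"

lemma det_four_block_minus_ones:
  fixes A D :: "'a :: idom mat"
  assumes A: "A \<in> carrier_mat n n" and D: "D \<in> carrier_mat m m"
  shows "det (four_block_mat A (- ones_mat n m) (- ones_mat m n) D)
    = det A * det (D + ones_mat m m) + det (A + ones_mat n n) * det D
      - det (A + ones_mat n n) * det (D + ones_mat m m)"
proof -
  define K where "K = four_block_mat (A + ones_mat n n) (0\<^sub>m n m) (0\<^sub>m m n) (D + ones_mat m m)"
  \<comment> \<open>\<open>u\<close> and \<open>v\<close> are the parts of the column of -1's on the
    first \<open>n\<close> and the last \<open>m\<close> rows. Adding \<open>u\<close> changes only
    the upper rows and \<open>v\<close> only the lower ones, so each sum keeps one zero off-diagonal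
    block.\<close>
  define u where "u = (\<lambda>i. if i < n then - 1 else 0 :: 'a)"
  define v where "v = (\<lambda>i. if i < n then 0 else - 1 :: 'a)"
  have uv: "u i + v i = - 1" for i
    by (simp add: u_def v_def)
  have K: "K \<in> carrier_mat (n + m) (n + m)"
    using A D by (auto simp: K_def)
  have "Matrix.mat (n + m) (n + m) (\<lambda>(i, j). K $$ (i, j) + (u i + v i) * 1)
      = four_block_mat A (- ones_mat n m) (- ones_mat m n) D"
    using A D by (intro eq_matI) (auto simp: K_def uv)
  moreover have "Matrix.mat (n + m) (n + m) (\<lambda>(i, j). K $$ (i, j) + u i * 1)
      = four_block_mat A (- ones_mat n m) (0\<^sub>m m n) (D + ones_mat m m)"
    using A D by (intro eq_matI) (auto simp: K_def u_def)
  moreover have "Matrix.mat (n + m) (n + m) (\<lambda>(i, j). K $$ (i, j) + v i * 1)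
      = four_block_mat (A + ones_mat n n) (0\<^sub>m n m) (- ones_mat m n) D"
    using A D by (intro eq_matI) (auto simp: K_def v_def)
  moreover have "det (four_block_mat A (- ones_mat n m) (0\<^sub>m m n) (D + ones_mat m m))
      = det A * det (D + ones_mat m m)"
    using A D by (intro det_four_block_mat_lower_left_zero) auto
  moreover have "det (four_block_mat (A + ones_mat n n) (0\<^sub>m n m) (- ones_mat m n) D)
      = det (A + ones_mat n n) * det D"
    using A D by (intro det_four_block_mat_upper_right_zero) auto
  moreover have "det K = det (A + ones_mat n n) * det (D + ones_mat m m)"
    unfolding K_def using A D by (intro det_four_block_mat_upper_right_zero) auto
  ultimately show ?thesis
    using det_add_rank_one_split[OF K, of u v "\<lambda>_. 1"] by simp
qed

section \<open>Matrices indexed by vertex lists\<close>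

text \<open>Entries depend on vertices rather than positions, so reordering the list permutes rows
  and columns simultaneously.\<close>

definition indexed_mat :: "'v list \<Rightarrow> ('v \<Rightarrow> 'v \<Rightarrow> 'a) \<Rightarrow> 'a mat" where
  "indexed_mat vs g = Matrix.mat (length vs) (length vs) (\<lambda>(i, j). g (vs ! i) (vs ! j))"

lemma indexed_mat_carrier [simp]: "indexed_mat vs g \<in> carrier_mat (length vs) (length vs)"
  by (simp add: indexed_mat_def)

lemma det_indexed_mat_permute:
  fixes g :: "'v \<Rightarrow> 'v \<Rightarrow> 'a :: comm_ring_1"
  assumes "mset us = mset vs"
  shows "det (indexed_mat us g) = det (indexed_mat vs g)"
proof -
  define n where "n = length vs"
  obtain p where p: "p permutes {..<n}" and us: "permute_list p vs = us"
    using mset_eq_permutation[OF assms] by (auto simp: n_def)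
  have p': "p permutes {0..<n}"
    using p by (simp add: lessThan_atLeast0)
  have p_less: "p i < n" if "i < n" for i
    using permutes_in_image[OF p, of i] that by simp
  have nth: "us ! i = vs ! p i" if "i < n" for i
    using us that permute_list_nth[of p vs i] p by (simp add: n_def)
  have len: "length us = n"
    using us by (auto simp: n_def)
  define A where "A = indexed_mat vs g"
  define R where "R = Matrix.mat n n (\<lambda>(i, j). A $$ (p i, j))"
  have A: "A \<in> carrier_mat n n" and R: "R \<in> carrier_mat n n"
    by (simp_all add: A_def R_def n_def)
  \<comment> \<open>\<open>R\<close> is \<open>A\<close> with its rows permuted; permuting its
    columns as well is a row permutation of the transpose. The sign of \<open>p\<close> thus occurs
    twice and cancels.\<close>
  have "transpose_mat (indexed_mat us g) = Matrix.mat n n (\<lambda>(i, j). transpose_mat R $$ (p i, j))"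
    by (rule eq_matI) (auto simp: indexed_mat_def len R_def A_def nth p_less n_def[symmetric])
  then have "det (transpose_mat (indexed_mat us g)) = signof p * det (transpose_mat R)"
    using det_permute_rows[of "transpose_mat R" n, OF _ p'] R by simp
  then have "det (indexed_mat us g) = signof p * det R"
    using det_transpose[OF R] det_transpose[OF indexed_mat_carrier[of us g]] by simp
  also have "det R = signof p * det A"
    unfolding R_def by (rule det_permute_rows[OF A p'])
  also have "signof p * (signof p * det A) = det A"
    by (simp add: sign_def)
  finally show ?thesis
    by (simp add: A_def)
qed

lemma poly_Q_poly:
  assumes "distinct vs"
  shows "poly (Q_poly vs G) x = det (indexed_mat vs (\<lambda>a b.
    (if a = b then x - real (out_degree (with_proj G) a) else 0) - (if (a, b) \<in> parcs G then 1 else 0)))"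
proof -
  have "signless_laplacian vs G \<in> carrier_mat (length vs) (length vs)"
    by (auto simp: signless_laplacian_def degree_mat_def adjacency_mat_def)
  \<comment> \<open>\<open>char_matrix\<close> is Q - xI, hence the negation. Distinctness makes
    equality of vertices the same as equality of positions, so \<open>a = b\<close> marks the
    diagonal.\<close>
  moreover have "- char_matrix (signless_laplacian vs G) x = indexed_mat vs (\<lambda>a b.
    (if a = b then x - real (out_degree (with_proj G) a) else 0) - (if (a, b) \<in> parcs G then 1 else 0))"
    using assms
    by (intro eq_matI) (auto simp: char_matrix_def signless_laplacian_def degree_mat_def
        adjacency_mat_def mat_diag_def indexed_mat_def nth_eq_iff_index_eq)
  ultimately show ?thesis
    unfolding Q_poly_def by (simp add: char_poly_matrix)
qed

section \<open>Degrees in joins and complements\<close>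

lemma out_degree_with_proj: "out_degree (with_proj G) v = card {w. (v, w) \<in> parcs G}"
proof -
  have "out_arcs (with_proj G) v = Pair v ` {w. (v, w) \<in> parcs G}"
    by (auto simp: out_arcs_def)
  then show ?thesis
    by (simp add: out_degree_def card_image inj_on_def)
qed

lemma graph_join_commute: "graph_join G H = graph_join H G"
  by (auto simp: graph_join_def)

lemma (in pair_fin_digraph) finite_out_neighbours: "finite {w. (v, w) \<in> parcs G}"
  by (rule finite_subset[OF _ pair_finite_verts]) (auto dest: arc_snd_in_verts)

lemma out_degree_graph_join:
  assumes "pair_fin_digraph G" and "pair_fin_digraph H"
    and disj: "pverts G \<inter> pverts H = {}" and v: "v \<in> pverts G"
  shows "out_degree (with_proj (graph_join G H)) v = out_degree (with_proj G) v + card (pverts H)"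
proof -
  interpret G: pair_fin_digraph G by fact
  interpret H: pair_fin_digraph H by fact
  have "{w. (v, w) \<in> parcs (graph_join G H)} = {w. (v, w) \<in> parcs G} \<union> pverts H"
    using v disj by (auto simp: graph_join_def disjoint_iff dest: H.arc_fst_in_verts)
  moreover have "{w. (v, w) \<in> parcs G} \<inter> pverts H = {}"
    using disj by (auto simp: disjoint_iff dest: G.arc_snd_in_verts)
  ultimately show ?thesis
    using G.finite_out_neighbours H.pair_finite_verts
    by (simp add: out_degree_with_proj card_Un_disjoint)
qed

text \<open>The vertex \<open>v\<close>, its neighbours and its non-neighbours partition the vertex
  set; absence of loops keeps \<open>v\<close> out of its own neighbourhood.\<close>

lemma out_degree_graph_complement:
  assumes "pair_graph G" and v: "v \<in> pverts G"
  shows "real (out_degree (with_proj (graph_complement G)) v)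
    = real (card (pverts G)) - 1 - real (out_degree (with_proj G) v)"
proof -
  interpret pair_graph G by fact
  let ?N = "{w. (v, w) \<in> parcs G}" and ?N' = "{w. (v, w) \<in> parcs (graph_complement G)}"
  have eq: "pverts G = insert v (?N \<union> ?N')"
    using v by (auto simp: graph_complement_def dest: arc_snd_in_verts)
  have "finite ?N'"
    by (rule finite_subset[OF _ pair_finite_verts]) (auto simp: graph_complement_def)
  moreover have "?N \<inter> ?N' = {}" and "v \<notin> ?N \<union> ?N'"
    by (auto simp: graph_complement_def dest: pair_no_loops)
  ultimately have "card (pverts G) = 1 + (card ?N + card ?N')"
    using finite_out_neighbours by (subst eq) (simp add: card_Un_disjoint)
  then show ?thesis
    by (simp add: out_degree_with_proj)
qed

lemma poly_Q_poly_graph_complement: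
  assumes "pair_graph G" and vs: "enumerates_vertices vs G"
  shows "(- 1) ^ card (pverts G) * poly (Q_poly vs (graph_complement G)) (real (card (pverts G)) - 2 - x)
    = det (indexed_mat vs (\<lambda>a b. (if a = b then x - real (out_degree (with_proj G) a) else 0)
        - (if (a, b) \<in> parcs G then 1 else 0)) + ones_mat (length vs) (length vs))"
proof -
  interpret pair_graph G by fact
  have dist: "distinct vs" and set: "set vs = pverts G"
    using vs by (simp_all add: enumerates_vertices_def)
  have len: "card (pverts G) = length vs"
    using dist set distinct_card[of vs] by simp
  define y where "y = real (card (pverts G)) - 2 - x"
  let ?C = "indexed_mat vs (\<lambda>a b. (if a = b then y - real (out_degree (with_proj (graph_complement G)) a) else 0)
        - (if (a, b) \<in> parcs (graph_complement G) then 1 else 0))"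
  \<comment> \<open>On the diagonal, y minus the complement degree n - 1 - d equals -(x - d + 1) by
    the choice of \<open>y\<close>. Off the diagonal, adjacency in the complement is 1 minus
    adjacency in \<open>G\<close>.\<close>
  have "- 1 \<cdot>\<^sub>m ?C = indexed_mat vs (\<lambda>a b. (if a = b then x - real (out_degree (with_proj G) a) else 0)
        - (if (a, b) \<in> parcs G then 1 else 0)) + ones_mat (length vs) (length vs)" (is "_ = ?R")
  proof (rule eq_matI)
    fix i j assume "i < dim_row ?R" and "j < dim_col ?R"
    then have i: "i < length vs" and j: "j < length vs" by auto
    have verts: "vs ! i \<in> pverts G" "vs ! j \<in> pverts G"
      using nth_mem[OF i] nth_mem[OF j] unfolding set by this+
    have arcs: "(vs ! i, vs ! j) \<in> parcs (graph_complement G)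
        \<longleftrightarrow> vs ! i \<noteq> vs ! j \<and> (vs ! i, vs ! j) \<notin> parcs G"
      using verts by (simp add: graph_complement_def)
    have "(vs ! i, vs ! i) \<notin> parcs G"
      using pair_no_loops[of "(vs ! i, vs ! i)"] by auto
    then show "(- 1 \<cdot>\<^sub>m ?C) $$ (i, j) = ?R $$ (i, j)"
      using i j arcs out_degree_graph_complement[OF assms(1) verts(2)]
      by (cases "vs ! i = vs ! j") (simp_all add: indexed_mat_def y_def)
  qed (auto simp: indexed_mat_def)
  then have "det ?R = (- 1) ^ length vs * det ?C"
    using det_smult[of "- 1" ?C] by (simp add: indexed_mat_def)
  then show ?thesis
    unfolding y_def[symmetric] by (simp add: poly_Q_poly[OF dist] len)
qed

section \<open>Block form of the join and its determinant\<close>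

theorem theorem2p3:
  fixes G1 G2 :: "'a pair_pre_digraph"
    and vs1 vs2 vs :: "'a list"
    and n1 n2 :: nat
    and lam :: real
  assumes "pair_graph G1" and "pair_graph G2"
    and "Digraph_Component.connected (with_proj G1)"
    and "Digraph_Component.connected (with_proj G2)"
    and "pverts G1 \<inter> pverts G2 = {}"
    and "card (pverts G1) = n1" and "card (pverts G2) = n2"
    and "enumerates_vertices vs1 G1"
    and "enumerates_vertices vs2 G2"
    and "enumerates_vertices vs (graph_join G1 G2)"
  shows "poly (Q_poly vs (graph_join G1 G2)) lam =
      (- 1) ^ n2 * poly (Q_poly vs1 G1) (lam - real n2)
        * poly (Q_poly vs2 (graph_complement G2)) (real n1 + real n2 - lam - 2)
    + (- 1) ^ n1 * poly (Q_poly vs2 G2) (lam - real n1)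
        * poly (Q_poly vs1 (graph_complement G1)) (real n1 + real n2 - lam - 2)
    - (- 1) ^ (n1 + n2)
        * poly (Q_poly vs1 (graph_complement G1)) (real n1 + real n2 - lam - 2)
        * poly (Q_poly vs2 (graph_complement G2)) (real n1 + real n2 - lam - 2)"
proof -
  interpret G1: pair_graph G1 by fact
  interpret G2: pair_graph G2 by fact
  have fin: "pair_fin_digraph G1" "pair_fin_digraph G2" by unfold_locales
  note disj = assms(5) and card1 = assms(6) and card2 = assms(7)
  have vs1: "distinct vs1" "set vs1 = pverts G1" and vs2: "distinct vs2" "set vs2 = pverts G2"
    and vs: "distinct vs" "set vs = pverts G1 \<union> pverts G2"
    using assms(8-10) by (simp_all add: enumerates_vertices_def graph_join_def)
  have len1: "length vs1 = n1" and len2: "length vs2 = n2"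
    using vs1 vs2 card1 card2 distinct_card by metis+
  define g where "g = (\<lambda>(G :: 'a pair_pre_digraph) x a b. (if a = b then x - real (out_degree (with_proj G) a) else 0)
        - (if (a, b) \<in> parcs G then 1 else 0 :: real))"
  \<comment> \<open>Each vertex of \<open>G1\<close> gains \<open>n2\<close> neighbours in the join;
    the shifted argument absorbs this increase.\<close>
  define M1 where "M1 = indexed_mat vs1 (g G1 (lam - real n2))"
  define M2 where "M2 = indexed_mat vs2 (g G2 (lam - real n1))"
  have M1: "M1 \<in> carrier_mat n1 n1" and M2: "M2 \<in> carrier_mat n2 n2"
    by (simp_all add: M1_def M2_def flip: len1 len2)
  have Q1: "poly (Q_poly vs1 G1) (lam - real n2) = det M1"
    by (simp add: poly_Q_poly[OF vs1(1)] M1_def g_def)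
  have Q2: "poly (Q_poly vs2 G2) (lam - real n1) = det M2"
    by (simp add: poly_Q_poly[OF vs2(1)] M2_def g_def)
  \<comment> \<open>With x = lam - n2, the complement's argument n1 - 2 - x is n1 + n2 - lam -
    2.\<close>
  have C1: "(- 1) ^ n1 * poly (Q_poly vs1 (graph_complement G1)) (real n1 + real n2 - lam - 2)
      = det (M1 + ones_mat n1 n1)"
    using poly_Q_poly_graph_complement[OF assms(1,8), of "lam - real n2"]
    by (simp add: card1 len1 M1_def g_def algebra_simps)
  have C2: "(- 1) ^ n2 * poly (Q_poly vs2 (graph_complement G2)) (real n1 + real n2 - lam - 2)
      = det (M2 + ones_mat n2 n2)"
    using poly_Q_poly_graph_complement[OF assms(2,9), of "lam - real n1"]
    by (simp add: card2 len2 M2_def g_def algebra_simps)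
  \<comment> \<open>The given enumeration \<open>vs\<close> may interleave the two graphs; its
    determinant is that of the block ordering \<open>vs1 @ vs2\<close>.\<close>
  have mset: "mset vs = mset (vs1 @ vs2)"
    using vs vs1 vs2 disj by (subst set_eq_iff_mset_eq_distinct[symmetric]) auto
  let ?J = "g (graph_join G1 G2) lam"
  have g11: "?J a b = g G1 (lam - real n2) a b" if "a \<in> pverts G1" "b \<in> pverts G1" for a b
    using that disj out_degree_graph_join[OF fin disj, of a] card2
    by (auto simp: g_def graph_join_def disjoint_iff dest: G2.arc_fst_in_verts)
  have g22: "?J a b = g G2 (lam - real n1) a b" if "a \<in> pverts G2" "b \<in> pverts G2" for a b
  proof -
    \<comment> \<open>The degree lemma treats vertices of the left operand, so the join is commuted
      first.\<close>
    have "out_degree (with_proj (graph_join G1 G2)) a = out_degree (with_proj G2) a + n1"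
      using that disj out_degree_graph_join[OF fin(2,1), of a] card1
      by (simp add: graph_join_commute[of G1 G2] Int_commute)
    then show ?thesis
      using that disj by (auto simp: g_def graph_join_def disjoint_iff dest: G1.arc_fst_in_verts)
  qed
  have g12: "?J a b = - 1" "?J b a = - 1" if "a \<in> pverts G1" "b \<in> pverts G2" for a b
    using that disj by (auto simp: g_def graph_join_def disjoint_iff)
  have "indexed_mat (vs1 @ vs2) ?J = four_block_mat M1 (- ones_mat n1 n2) (- ones_mat n2 n1) M2"
    (is "?L = ?R")
  proof (rule eq_matI)
    fix i j assume "i < dim_row ?R" and "j < dim_col ?R"
    then have i: "i < n1 + n2" and j: "j < n1 + n2"
      using M1 M2 by auto
    have nth1: "vs1 ! k \<in> pverts G1" if "k < n1" for k
      using that nth_mem[of k vs1] unfolding vs1(2) len1 by blast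
    have nth2: "vs2 ! (k - n1) \<in> pverts G2" if "k < n1 + n2" "\<not> k < n1" for k
    proof -
      have "k - n1 < length vs2" using that len2 by simp
      from nth_mem[OF this] show ?thesis unfolding vs2(2) .
    qed
    show "?L $$ (i, j) = ?R $$ (i, j)"
      using i j by (auto simp: indexed_mat_def len1 len2 nth_append M1_def M2_def g11 g22 g12 nth1 nth2)
  qed (use M1 M2 len1 len2 in \<open>auto simp: indexed_mat_def\<close>)
  then have "poly (Q_poly vs (graph_join G1 G2)) lam
      = det M1 * det (M2 + ones_mat n2 n2) + det (M1 + ones_mat n1 n1) * det M2
        - det (M1 + ones_mat n1 n1) * det (M2 + ones_mat n2 n2)"
    using det_indexed_mat_permute[OF mset, of ?J] det_four_block_minus_ones[OF M1 M2]
    by (simp add: poly_Q_poly[OF vs(1)] g_def)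
  \<comment> \<open>Splitting (-1)^(n1 + n2) gives each complement polynomial the sign that turns it
    into a determinant with all-ones added.\<close>
  then show ?thesis
    unfolding Q1 Q2 C1[symmetric] C2[symmetric] by (simp add: power_add algebra_simps)
qed

end
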